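(* Let $G$ be a group that has a finite presentation with isoperimetric function $\le P(\cdot)$. Then $G$ also has a finite presentation with respect to which the isoperimetric function is $\le P(n)/2+n/2$.
   Context: For a finite presentation $\langle A;R\rangle$: $A$ is a finite alphabet, $A^{-1}$ a disjoint copy, $A^{\pm1}=A\cup A^{-1}$, $(A^{\pm1})^*$ the set of words over $A^{\pm1}$, $|w|$ the length of a word; $R\subset(A^{\pm1})^*$ is finite and does not contain the empty word; $R^{\pm1}=R\cup\{r^{-1}:r\in R\}$; $x^y=y^{-1}xy$; $=_{\mathrm{FG}}$ is equality in the free group on $A$. That the isoperimetric function of $\langle A;R\rangle$ is $\le P(\cdot)$ (for $P:\mathbb N\to\mathbb N$, or more generally a bound $n\mapsto P(n)$) means: every word $w\in(A^{\pm1})^*$ that represents the identity of the presented group satisfies $w=_{\mathrm{FG}}\prod_{i\in I}r_i^{x_i}$ for some finite sequence $(r_i:i\in I)$ in $R^{\pm1}$ and some finite sequence $(x_i:i\in I)$ of words in $(A^{\pm1})^*$ with $|I|\le P(|w|)$. Equivalently, every such $w$ has a van Kampen diagram of area at most $P(|w|)$. *)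

theory Defs
  imports Complex_Main "HOL-Algebra.Coset"
begin

text \<open>The letter \<open>(a, True)\<close> stands for \<open>a\<close> and \<open>(a, False)\<close> for \<open>a\<inverse>\<close>.\<close>

type_synonym 'a word = "('a \<times> bool) list"

definition letters :: "'a set \<Rightarrow> ('a \<times> bool) set" where
  "letters A = A \<times> UNIV"

definition words :: "'a set \<Rightarrow> 'a word set" where
  "words A = lists (letters A)"

definition inv_letter :: "'a \<times> bool \<Rightarrow> 'a \<times> bool" where
  "inv_letter x = (fst x, \<not> snd x)"

definition inv_word :: "'a word \<Rightarrow> 'a word" where
  "inv_word w = rev (map inv_letter w)"

definition conj_word :: "'a word \<Rightarrow> 'a word \<Rightarrow> 'a word" where
  "conj_word x y = inv_word y @ x @ y"

inductive free_eq :: "'a set \<Rightarrow> 'a word \<Rightarrow> 'a word \<Rightarrow> bool" for A :: "'a set" where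
  cancel: "u \<in> words A \<Longrightarrow> v \<in> words A \<Longrightarrow> x \<in> letters A
    \<Longrightarrow> free_eq A (u @ [x, inv_letter x] @ v) (u @ v)"
| refl: "u \<in> words A \<Longrightarrow> free_eq A u u"
| sym: "free_eq A u v \<Longrightarrow> free_eq A v u"
| trans: "free_eq A u v \<Longrightarrow> free_eq A v w \<Longrightarrow> free_eq A u w"

definition free_rel :: "'a set \<Rightarrow> 'a word rel" where
  "free_rel A = {(u, v). free_eq A u v}"

definition free_class :: "'a set \<Rightarrow> 'a word \<Rightarrow> 'a word set" where
  "free_class A w = free_rel A `` {w}"

text \<open>All classes in the union below coincide, because \<open>free_eq A\<close> is a congruence
  for concatenation (see \<open>free_group_mult\<close>).\<close>

definition free_group :: "'a set \<Rightarrow> 'a word set monoid" where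
  "free_group A = \<lparr>carrier = words A // free_rel A,
     mult = (\<lambda>X Y. \<Union>u\<in>X. \<Union>v\<in>Y. free_class A (u @ v)),
     one = free_class A []\<rparr>"

definition normal_closure :: "('g, 'm) monoid_scheme \<Rightarrow> 'g set \<Rightarrow> 'g set" where
  "normal_closure G S = \<Inter>{N. N \<lhd> G \<and> S \<subseteq> N}"

definition finite_presentation :: "'a set \<Rightarrow> 'a word set \<Rightarrow> bool" where
  "finite_presentation A R \<longleftrightarrow> finite A \<and> finite R \<and> R \<subseteq> words A \<and> [] \<notin> R"

definition relator_closure :: "'a set \<Rightarrow> 'a word set \<Rightarrow> 'a word set set" where
  "relator_closure A R = normal_closure (free_group A) (free_class A ` R)"

definition presented_group :: "'a set \<Rightarrow> 'a word set \<Rightarrow> 'a word set set monoid" where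
  "presented_group A R = free_group A Mod relator_closure A R"

definition word_value :: "'a set \<Rightarrow> 'a word set \<Rightarrow> 'a word \<Rightarrow> 'a word set set" where
  "word_value A R w = relator_closure A R #>\<^bsub>free_group A\<^esub> free_class A w"

definition has_finite_presentation ::
    "('g, 'm) monoid_scheme \<Rightarrow> 'a set \<Rightarrow> 'a word set \<Rightarrow> bool" where
  "has_finite_presentation G A R \<longleftrightarrow> finite_presentation A R \<and> G \<cong> presented_group A R"

definition sym_relators :: "'a word set \<Rightarrow> 'a word set" where
  "sym_relators R = R \<union> inv_word ` R"

text \<open>The list \<open>rxs\<close> is the sequence of pairs \<open>(r\<^sub>i, x\<^sub>i)\<close>. The bound is real-valued
  because half-integers occur.\<close>

definition isoperimetric_le :: "'a set \<Rightarrow> 'a word set \<Rightarrow> (nat \<Rightarrow> real) \<Rightarrow> bool" where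
  "isoperimetric_le A R P \<longleftrightarrow>
    (\<forall>w \<in> words A. word_value A R w = \<one>\<^bsub>presented_group A R\<^esub> \<longrightarrow>
      (\<exists>rxs. set rxs \<subseteq> sym_relators R \<times> words A \<and>
             free_eq A w (concat (map (\<lambda>(r, x). conj_word r x) rxs)) \<and>
             real (length rxs) \<le> P (length w)))"

lemma words_append [simp]: "u @ v \<in> words A \<longleftrightarrow> u \<in> words A \<and> v \<in> words A"
  by (auto simp: words_def)

lemma words_Nil [simp]: "[] \<in> words A"
  by (simp add: words_def)

lemma words_Cons [simp]: "x # w \<in> words A \<longleftrightarrow> x \<in> letters A \<and> w \<in> words A"
  by (auto simp: words_def)

lemma inv_letter_letters [simp]: "inv_letter x \<in> letters A \<longleftrightarrow> x \<in> letters A"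
  by (cases x) (auto simp: inv_letter_def letters_def)

lemma inv_letter_inv [simp]: "inv_letter (inv_letter x) = x"
  by (simp add: inv_letter_def)

lemma inv_word_words [simp]: "w \<in> words A \<Longrightarrow> inv_word w \<in> words A"
  by (induction w) (auto simp: inv_word_def)

lemma free_eq_words: "free_eq A u v \<Longrightarrow> u \<in> words A \<and> v \<in> words A"
  by (induction rule: free_eq.induct) auto

lemma equiv_free_rel: "equiv (words A) (free_rel A)"
  by (rule equivI)
    (auto simp: free_rel_def refl_on_def sym_def trans_def
      intro: free_eq.intros dest: free_eq_words)

lemma free_eq_append_left: "free_eq A u v \<Longrightarrow> w \<in> words A \<Longrightarrow> free_eq A (w @ u) (w @ v)"
proof (induction rule: free_eq.induct)
  case (cancel u v x)
  then show ?case using free_eq.cancel[of "w @ u" A v x] by simp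
qed (auto intro: free_eq.intros)

lemma free_eq_append_right: "free_eq A u v \<Longrightarrow> w \<in> words A \<Longrightarrow> free_eq A (u @ w) (v @ w)"
proof (induction rule: free_eq.induct)
  case (cancel u v x)
  then show ?case using free_eq.cancel[of u A "v @ w" x] by simp
qed (auto intro: free_eq.intros)

lemma free_eq_append:
  "free_eq A u u' \<Longrightarrow> free_eq A v v' \<Longrightarrow> free_eq A (u @ v) (u' @ v')"
  by (meson free_eq.trans free_eq_append_left free_eq_append_right free_eq_words)

lemma free_class_eq_iff:
  "u \<in> words A \<Longrightarrow> v \<in> words A \<Longrightarrow> free_class A u = free_class A v \<longleftrightarrow> free_eq A u v"
  unfolding free_class_def using eq_equiv_class_iff[OF equiv_free_rel, of u A v]
  by (simp add: free_rel_def)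

lemma mem_free_class: "v \<in> free_class A u \<longleftrightarrow> free_eq A u v"
  by (simp add: free_class_def free_rel_def)

lemma free_group_mult:
  assumes "u \<in> words A" "v \<in> words A"
  shows "free_class A u \<otimes>\<^bsub>free_group A\<^esub> free_class A v = free_class A (u @ v)"
proof -
  let ?U = "free_class A u" and ?V = "free_class A v"
  have "free_class A (u' @ v') = free_class A (u @ v)" if "u' \<in> ?U" "v' \<in> ?V" for u' v'
  proof -
    have *: "free_eq A (u @ v) (u' @ v')"
      using that by (intro free_eq_append) (simp_all add: mem_free_class)
    then have "u' @ v' \<in> words A" "u @ v \<in> words A"
      using free_eq_words by blast+
    then show ?thesis
      using * by (metis free_class_eq_iff)
  qed
  then have "(\<Union>u'\<in>?U. \<Union>v'\<in>?V. free_class A (u' @ v')) =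
      (\<Union>u'\<in>?U. \<Union>v'\<in>?V. free_class A (u @ v))"
    by (intro SUP_cong HOL.refl)
  also have "\<dots> = free_class A (u @ v)"
  proof -
    have "u \<in> ?U" "v \<in> ?V"
      using assms by (simp_all add: mem_free_class free_eq.refl)
    then show ?thesis by blast
  qed
  finally show ?thesis
    by (simp add: free_group_def)
qed

lemma free_group_carrier: "carrier (free_group A) = free_class A ` words A"
  by (auto simp: free_group_def quotient_def free_class_def)

lemma free_eq_inv_word: "w \<in> words A \<Longrightarrow> free_eq A (inv_word w @ w) []"
proof (induction w)
  case Nil
  then show ?case by (simp add: inv_word_def free_eq.refl)
next
  case (Cons x w)
  then have "free_eq A (inv_word w @ [inv_letter x, inv_letter (inv_letter x)] @ w)
      (inv_word w @ w)"
    by (intro free_eq.cancel) auto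
  with Cons show ?case
    by (auto simp: inv_word_def intro: free_eq.trans)
qed

lemma group_free_group: "group (free_group A)"
proof (rule groupI)
  have one: "\<one>\<^bsub>free_group A\<^esub> = free_class A []"
    by (simp add: free_group_def)
  show "\<one>\<^bsub>free_group A\<^esub> \<in> carrier (free_group A)"
    by (simp add: one free_group_carrier)
  show "\<exists>Y \<in> carrier (free_group A). Y \<otimes>\<^bsub>free_group A\<^esub> X = \<one>\<^bsub>free_group A\<^esub>"
    if X: "X \<in> carrier (free_group A)" for X
  proof -
    obtain w where w: "w \<in> words A" "X = free_class A w"
      using X by (auto simp: free_group_carrier)
    then have "free_class A (inv_word w) \<otimes>\<^bsub>free_group A\<^esub> X = \<one>\<^bsub>free_group A\<^esub>"
      by (simp add: free_group_mult one free_class_eq_iff free_eq_inv_word)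
    with w show ?thesis
      by (auto simp: free_group_carrier)
  qed
  show "\<one>\<^bsub>free_group A\<^esub> \<otimes>\<^bsub>free_group A\<^esub> X = X"
    if "X \<in> carrier (free_group A)" for X
    using that by (auto simp: one free_group_carrier free_group_mult)
qed (auto simp: free_group_carrier free_group_mult)

lemma normal_closure_normal:
  assumes "group G" "S \<subseteq> carrier G"
  shows "normal_closure G S \<lhd> G"
proof -
  interpret group G by fact
  let ?\<N> = "{N. N \<lhd> G \<and> S \<subseteq> N}"
  have car: "carrier G \<lhd> G"
    by (simp add: normal_inv_iff subgroup_self)
  have "subgroup (\<Inter>?\<N>) G"
    using car assms(2) by (intro subgroups_Inter) (auto simp: normal_inv_iff)
  then show ?thesis
    unfolding normal_closure_def normal_inv_iff by blast
qed

lemma group_presented_group: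
  assumes "R \<subseteq> words A"
  shows "group (presented_group A R)"
  unfolding presented_group_def relator_closure_def
  using assms
  by (intro normal.factorgroup_is_group normal_closure_normal group_free_group)
    (auto simp: free_group_carrier)

lemma word_value_eq_one_iff:
  assumes "R \<subseteq> words A" "w \<in> words A"
  shows "word_value A R w = \<one>\<^bsub>presented_group A R\<^esub> \<longleftrightarrow>
    free_class A w \<in> relator_closure A R"
proof -
  interpret F: group "free_group A" by (rule group_free_group)
  have "relator_closure A R \<lhd> free_group A"
    unfolding relator_closure_def using assms(1)
    by (intro normal_closure_normal group_free_group) (auto simp: free_group_carrier)
  then have H: "subgroup (relator_closure A R) (free_group A)"
    by (rule normal_imp_subgroup)
  have "free_class A w \<in> carrier (free_group A)"
    using assms(2) by (simp add: free_group_carrier)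
  with H show ?thesis
    unfolding word_value_def presented_group_def FactGroup_def
    using F.coset_join1 F.coset_join2 by (auto dest: subgroup.subset)
qed

end

theory Submission
  imports Defs
begin

text \<open>Peel a van Kampen diagram from its boundary. A boundary edge \<open>b\<close> of a face is replaced by the
  rest of the boundary of that face; repeating this with the newly exposed edges removes all faces,
  and leaves a freely trivial word. The faces thereby form a forest of rooted trees of bounded degree,
  with at most one tree per letter of the boundary word \<open>w\<close>. Each tree with \<open>k\<close> faces splits into
  connected groups of bounded size, all of at least two faces with the possible exception of the
  group of the root, so that there are at most \<open>(k + 1) / 2\<close> groups. The boundary of a group is a
  consequence of \<open>R\<close> of bounded length, and these consequences are the new relators. Planarity never
  enters: that peeling succeeds for every word with trivial value is shown algebraically, by
  following the forest through a free cancellation.\<close>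

section \<open>Inverse words and free equality\<close>

lemma inv_word_Nil [simp]: "inv_word [] = []"
  by (simp add: inv_word_def)

lemma inv_word_Cons [simp]: "inv_word (x # w) = inv_word w @ [inv_letter x]"
  by (simp add: inv_word_def)

lemma inv_word_append [simp]: "inv_word (u @ v) = inv_word v @ inv_word u"
  by (simp add: inv_word_def)

lemma inv_word_inv_word [simp]: "inv_word (inv_word w) = w"
  by (induction w) auto

lemma length_inv_word [simp]: "length (inv_word w) = length w"
  by (simp add: inv_word_def)

lemma inv_word_words_iff [simp]: "inv_word w \<in> words A \<longleftrightarrow> w \<in> words A"
  using inv_word_words inv_word_inv_word by metis

lemma append_eq_append_Cons_cases:
  assumes "x @ y = p @ b # q"
  obtains (left) q1 where "x = p @ b # q1" "q = q1 @ y"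
    | (right) p1 where "p = x @ p1" "y = p1 @ b # q"
proof -
  from assms consider r where "x = p @ r" "r @ y = b # q" | r where "p = x @ r" "y = r @ b # q"
    by (auto simp: append_eq_append_conv2)
  then show ?thesis
  proof cases
    case 1
    \<comment> \<open>If \<open>r\<close> is empty, the marked letter is the first of
      \<open>y\<close>: this is \<open>right\<close> with an empty \<open>p1\<close>.\<close>
    then show ?thesis
      using left right[of "[]"] by (cases r) auto
  next
    case 2
    then show ?thesis
      by (rule right)
  qed
qed

lemma free_eq_inv_word_right: "w \<in> words A \<Longrightarrow> free_eq A (w @ inv_word w) []"
  using free_eq_inv_word[of "inv_word w" A] by simp

lemma free_eq_inv_word_cong: "free_eq A u v \<Longrightarrow> free_eq A (inv_word u) (inv_word v)"
proof (induction rule: free_eq.induct)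
  case (cancel u v x)
  then show ?case
    using free_eq.cancel[of "inv_word v" A "inv_word u" x] by simp
qed (auto intro: free_eq.intros)

lemma free_eq_drop:
  assumes "free_eq A p []" "u \<in> words A" "v \<in> words A"
  shows "free_eq A (u @ p @ v) (u @ v)"
  using free_eq_append_left[OF free_eq_append_right[OF assms(1,3)] assms(2)] by simp

text \<open>Conjugation by \<open>v\<close> carries \<open>u @ v\<close> to \<open>v @ u\<close> and
  fixes the identity.\<close>

lemma free_eq_rotate:
  assumes "free_eq A (u @ v) []"
  shows "free_eq A (v @ u) []"
proof -
  have w: "u \<in> words A" "v \<in> words A"
    using free_eq_words[OF assms] by auto
  have "free_eq A (v @ u @ v @ inv_word v) (v @ inv_word v)"
    using free_eq_drop[OF assms, of v "inv_word v"] w by simp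
  moreover have "free_eq A (v @ u @ v @ inv_word v) (v @ u)"
    using free_eq_append_left[OF free_eq_inv_word_right, of v A "v @ u"] w by simp
  ultimately show ?thesis
    using free_eq_inv_word_right[OF w(2)] by (meson free_eq.sym free_eq.trans)
qed

lemma free_eq_move_left:
  assumes "free_eq A (c @ v) u" "c \<in> words A" "v \<in> words A"
  shows "free_eq A v (inv_word c @ u)"
proof -
  have "free_eq A (inv_word c @ c @ v) v"
    using free_eq_append_right[OF free_eq_inv_word, of c A v] assms by simp
  moreover have "free_eq A (inv_word c @ c @ v) (inv_word c @ u)"
    using assms by (intro free_eq_append_left) auto
  ultimately show ?thesis
    by (meson free_eq.sym free_eq.trans)
qed

section \<open>Reduced forms in the free group\<close>

text \<open>A letter acts on reduced words by left multiplication with cancellation, as in van der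
  Waerden's proof of the normal form theorem.\<close>

definition push :: "'a \<times> bool \<Rightarrow> 'a word \<Rightarrow> 'a word" where
  "push x w = (if w \<noteq> [] \<and> hd w = inv_letter x then tl w else x # w)"

definition reduced_form :: "'a word \<Rightarrow> 'a word" where
  "reduced_form w = foldr push w []"

definition reduced :: "'a word \<Rightarrow> bool" where
  "reduced w \<longleftrightarrow> (\<forall>u x v. w \<noteq> u @ [x, inv_letter x] @ v)"

lemma reduced_tl: "reduced (x # w) \<Longrightarrow> reduced w"
  unfolding reduced_def by (metis append_Cons)

lemma reduced_Cons:
  assumes "reduced w" "w = [] \<or> hd w \<noteq> inv_letter x"
  shows "reduced (x # w)"
  unfolding reduced_def
proof (intro allI notI)
  fix u y v
  assume *: "x # w = u @ [y, inv_letter y] @ v"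
  show False
    using assms * unfolding reduced_def by (cases u) (auto simp del: split_paired_All)
qed

lemma reduced_push: "reduced w \<Longrightarrow> reduced (push x w)"
  by (cases w) (auto simp: push_def intro: reduced_Cons reduced_tl)

lemma push_push:
  assumes "reduced w"
  shows "push x (push (inv_letter x) w) = w"
proof (cases w)
  case Nil
  then show ?thesis by (simp add: push_def)
next
  case (Cons y w')
  \<comment> \<open>If \<open>y = x\<close>, the inner \<open>push\<close> removes \<open>y\<close>,
    and the outer one restores it unless \<open>w'\<close> starts with its inverse; reducedness
    excludes that.\<close>
  have "\<not> (w' \<noteq> [] \<and> hd w' = inv_letter y)"
    using assms Cons unfolding reduced_def
    by (metis append_Cons append_Nil list.collapse)
  then show ?thesis
    using Cons by (auto simp: push_def)
qed

lemma reduced_reduced_form: "reduced (reduced_form w)"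
proof (induction w)
  case Nil
  then show ?case by (simp add: reduced_form_def reduced_def)
next
  case (Cons x w)
  then show ?case by (simp add: reduced_form_def reduced_push)
qed

text \<open>\<open>reduced_form\<close> composes the actions of the letters, and by
  \<open>push_push\<close> a cancelling pair acts as the identity on the reduced form of what
  follows it.\<close>

lemma reduced_form_cong: "free_eq A u v \<Longrightarrow> reduced_form u = reduced_form v"
proof (induction rule: free_eq.induct)
  case (cancel u v x)
  then show ?case
    using push_push[OF reduced_reduced_form[of v], of x] by (simp add: reduced_form_def)
qed auto

lemma free_eq_push:
  assumes "x \<in> letters A" "w \<in> words A"
  shows "free_eq A (x # w) (push x w)"
proof (cases "w \<noteq> [] \<and> hd w = inv_letter x")
  case True
  then show ?thesis
    using free_eq.cancel[of "[]" A "tl w" x] assms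
    by (cases w) (auto simp: push_def)
qed (use assms in \<open>auto simp: push_def intro: free_eq.refl\<close>)

lemma free_eq_reduced_form: "w \<in> words A \<Longrightarrow> free_eq A w (reduced_form w)"
proof (induction w)
  case Nil
  then show ?case by (simp add: reduced_form_def free_eq.refl)
next
  case (Cons x w)
  then have "free_eq A ([x] @ w) ([x] @ reduced_form w)"
    by (intro free_eq_append_left) auto
  moreover have "free_eq A (x # reduced_form w) (push x (reduced_form w))"
    using Cons free_eq_words by (intro free_eq_push) auto
  ultimately show ?case
    by (auto simp: reduced_form_def intro: free_eq.trans)
qed

text \<open>If the first letter \<open>y\<close> of \<open>w\<close> does not survive, its partner
  stands behind a freely trivial stretch, and the search for \<open>b\<close> resumes after the
  partner; hence the induction on length.\<close>

lemma reduced_form_eq_ConsD: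
  "w \<in> words A \<Longrightarrow> reduced_form w = b # r \<Longrightarrow>
    \<exists>p q. w = p @ b # q \<and> free_eq A p [] \<and> reduced_form q = r"
proof (induction w arbitrary: b r rule: length_induct)
  case (1 w)
  then obtain y w' where w: "w = y # w'"
    by (cases w) (auto simp: reduced_form_def)
  have red: "push y (reduced_form w') = b # r"
    using 1 w by (simp add: reduced_form_def)
  show ?case
  proof (cases "reduced_form w' \<noteq> [] \<and> hd (reduced_form w') = inv_letter y")
    case False
    then have "b = y" "r = reduced_form w'"
      using red by (auto simp: push_def)
    then show ?thesis
      using w by - (rule exI[of _ "[]"], rule exI[of _ w'], auto intro: free_eq.refl)
  next
    case True
    then have "reduced_form w' = inv_letter y # b # r"
      using red by (cases "reduced_form w'") (auto simp: push_def)
    then obtain p1 q1 where 1: "w' = p1 @ inv_letter y # q1" "free_eq A p1 []"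
        "reduced_form q1 = b # r"
      using "1.IH"[rule_format, of w'] "1.prems" w by auto
    then obtain p q where 2: "q1 = p @ b # q" "free_eq A p []" "reduced_form q = r"
      using "1.IH"[rule_format, of q1] "1.prems" w by auto
    have y: "y \<in> letters A"
      using "1.prems" w by simp
    have "free_eq A (([y] @ p1 @ [inv_letter y]) @ p) ([] @ [])"
    proof (rule free_eq_append[OF _ 2(2)])
      have "free_eq A ([y] @ p1 @ [inv_letter y]) ([y] @ [inv_letter y])"
        using 1(2) y by (intro free_eq_drop) auto
      moreover have "free_eq A ([y] @ [inv_letter y]) []"
        using free_eq.cancel[of "[]" A "[]" y] y by simp
      ultimately show "free_eq A ([y] @ p1 @ [inv_letter y]) []"
        by (rule free_eq.trans)
    qed
    then show ?thesis
      using w 1 2 by - (rule exI[of _ "y # p1 @ inv_letter y # p"], rule exI[of _ q], auto)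
  qed
qed

text \<open>Some letter of \<open>y\<close> survives in the reduced form of \<open>y\<close> and cancels a letter of \<open>x\<close>.\<close>

lemma free_eq_append_Nil_cancel:
  assumes xy: "free_eq A (x @ y) []" and y: "\<not> free_eq A y []"
  obtains x1 b x2 p q where "x = x1 @ inv_letter b # x2" "y = p @ b # q"
    "free_eq A x2 []" "free_eq A p []"
proof -
  have w: "x \<in> words A" "y \<in> words A"
    using free_eq_words[OF xy] by auto
  have "reduced_form y \<noteq> []"
    using free_eq_reduced_form[OF w(2)] y by auto
  then obtain b r where r: "reduced_form y = b # r"
    by (cases "reduced_form y") auto
  \<comment> \<open>\<open>y\<close> and \<open>inv_word x\<close> share a reduced form, so the same
    letter \<open>b\<close> survives first in both; inverting the splitting of
    \<open>inv_word x\<close> locates its inverse in \<open>x\<close>.\<close>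
  have "free_eq A y (inv_word x)"
    using free_eq_move_left[OF xy w] by simp
  then have "reduced_form (inv_word x) = b # r"
    using reduced_form_cong r by metis
  then obtain p' q' where x: "inv_word x = p' @ b # q'" "free_eq A p' []"
    using reduced_form_eq_ConsD[of "inv_word x" A b r] w by auto
  obtain p q where "y = p @ b # q" "free_eq A p []"
    using reduced_form_eq_ConsD[OF w(2) r] by auto
  moreover have "x = inv_word q' @ inv_letter b # inv_word p'"
    using arg_cong[OF x(1), of inv_word] by simp
  moreover have "free_eq A (inv_word p') []"
    using free_eq_inv_word_cong[OF x(2)] by simp
  ultimately show ?thesis
    using that by blast
qed

section \<open>Forests of faces, re-rooting, and invariance under free equality\<close>

text \<open>A derivation is a forest planted on the letters of \<open>u\<close>, with
  \<open>k\<close> faces and frontier \<open>t\<close>. In \<open>replace\<close> the edge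
  \<open>b\<close> is crossed into a face with boundary \<open>inv_letter b # s\<close>, and further
  faces hang on the edges \<open>s\<close>.\<close>

inductive expands :: "'a word set \<Rightarrow> 'a word \<Rightarrow> 'a word \<Rightarrow> nat \<Rightarrow> bool" for C where
  Nil: "expands C [] [] 0"
| keep: "expands C u t k \<Longrightarrow> expands C (b # u) (b # t) k"
| replace: "inv_letter b # s \<in> C \<Longrightarrow> expands C s t1 k1 \<Longrightarrow> expands C u t2 k2 \<Longrightarrow>
    expands C (b # u) (t1 @ t2) (Suc (k1 + k2))"

lemma expands_refl: "expands C u u 0"
  by (induction u) (auto intro: expands.intros)

lemma expands_append:
  "expands C u t k \<Longrightarrow> expands C v t' k' \<Longrightarrow> expands C (u @ v) (t @ t') (k + k')"
proof (induction rule: expands.induct)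
  case (replace b s t1 k1 u t2 k2)
  then show ?case
    using expands.replace[of b s C t1 k1 "u @ v" "t2 @ t'" "k2 + k'"] by (simp add: ac_simps)
qed (auto intro: expands.intros)

lemma expands_appendD:
  "expands C (u @ v) t k \<Longrightarrow>
    \<exists>t1 t2 k1 k2. t = t1 @ t2 \<and> k = k1 + k2 \<and> expands C u t1 k1 \<and> expands C v t2 k2"
proof (induction "u @ v" t k arbitrary: u rule: expands.induct)
  case Nil
  then show ?case by (auto intro: expands.Nil)
next
  case (keep u' t k b)
  show ?case
  proof (cases u)
    case Nil
    then show ?thesis
      using expands.keep[OF keep.hyps(1), of b] keep.hyps(3)
      by - (rule exI[of _ "[]"], rule exI[of _ "b # t"], rule exI[of _ 0], rule exI[of _ k],
        auto intro: expands.Nil)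
  next
    case (Cons c u1)
    then obtain t1 t2 k1 k2 where "t = t1 @ t2" "k = k1 + k2" "expands C u1 t1 k1" "expands C v t2 k2"
      using keep.hyps(2)[of u1] keep.hyps(3) by auto
    then show ?thesis
      using Cons keep.hyps(3) expands.keep[of C u1 t1 k1 b]
      by - (rule exI[of _ "b # t1"], rule exI[of _ t2], rule exI[of _ k1], rule exI[of _ k2], auto)
  qed
next
  case (replace b s t1 k1 u' t2 k2)
  show ?case
  proof (cases u)
    case Nil
    then show ?thesis
      using expands.replace[OF replace.hyps(1,2,4)] replace.hyps(6)
      by - (rule exI[of _ "[]"], rule exI[of _ "t1 @ t2"], rule exI[of _ 0],
        rule exI[of _ "Suc (k1 + k2)"], auto intro: expands.Nil)
  next
    case (Cons c u1)
    then obtain t3 t4 k3 k4 where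
      "t2 = t3 @ t4" "k2 = k3 + k4" "expands C u1 t3 k3" "expands C v t4 k4"
      using replace.hyps(5)[of u1] replace.hyps(6) by auto
    then show ?thesis
      using Cons replace.hyps expands.replace[of b s C t1 k1 u1 t3 k3]
      by - (rule exI[of _ "t1 @ t3"], rule exI[of _ t4], rule exI[of _ "Suc (k1 + k3)"],
        rule exI[of _ k4], auto)
  qed
qed

text \<open>Grafting a second forest onto the leaves of the first adds the face counts.\<close>

lemma expands_trans: "expands C u t k \<Longrightarrow> expands C t t' k' \<Longrightarrow> expands C u t' (k + k')"
proof (induction arbitrary: t' k' rule: expands.induct)
  case Nil
  then show ?case by simp
next
  case (keep u t k b)
  then obtain t1 t2 k1 k2 where *:
    "t' = t1 @ t2" "k' = k1 + k2" "expands C [b] t1 k1" "expands C t t2 k2"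
    using expands_appendD[of C "[b]" t t' k'] by auto
  then show ?case
    using expands_append[OF *(3) keep.IH[OF *(4)]] by (simp add: ac_simps)
next
  case (replace b s t1 k1 u t2 k2)
  then obtain t3 t4 k3 k4 where *:
    "t' = t3 @ t4" "k' = k3 + k4" "expands C t1 t3 k3" "expands C t2 t4 k4"
    using expands_appendD[OF replace.prems] by auto
  then show ?case
    using expands.replace[OF replace.hyps(1) replace.IH(1)[OF *(3)] replace.IH(2)[OF *(4)]]
    by (simp add: ac_simps)
qed

lemma expands_replace_at:
  assumes "expands C u (t1 @ b # t2) k" "expands C [b] s l"
  shows "expands C u (t1 @ s @ t2) (k + l)"
proof -
  have "expands C (t1 @ [b] @ t2) (t1 @ s @ t2) (0 + (l + 0))"
    by (intro expands_append expands_refl assms)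
  then show ?thesis
    using expands_trans[OF assms(1)] by simp
qed

text \<open>The trees of faces behind an expansion have no preferred root: the tree above the letter
  \<open>c\<close> of \<open>u\<close> can be rooted at any letter \<open>b\<close> of its frontier instead.\<close>

lemma expands_reroot:
  assumes C: "\<And>p q. p @ q \<in> C \<Longrightarrow> q @ p \<in> C"
  shows "expands C u t k \<Longrightarrow> t = t1 @ b # t2 \<Longrightarrow>
    \<exists>u1 c u2 s1 r1 r2 s2 k1 k2 k3. u = u1 @ c # u2 \<and> t1 = s1 @ r1 \<and> t2 = r2 @ s2 \<and>
      k = k1 + k2 + k3 \<and> expands C u1 s1 k1 \<and> expands C u2 s2 k3 \<and>
      expands C [inv_letter b] (r2 @ inv_letter c # r1) k2"
proof (induction arbitrary: t1 t2 rule: expands.induct)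
  case Nil
  then show ?case by simp
next
  case (keep u t k c)
  show ?case
  proof (cases t1)
    case Nil
    then show ?thesis
      using keep.hyps keep.prems expands_refl[of C "[inv_letter b]"]
      by - (rule exI[of _ "[]"], rule exI[of _ c], rule exI[of _ u],
        rule exI[of _ "[]"], rule exI[of _ "[]"], rule exI[of _ "[]"], rule exI[of _ t],
        rule exI[of _ 0], rule exI[of _ 0], rule exI[of _ k], auto intro: expands.Nil)
  next
    case (Cons d t3)
    then have "t = t3 @ b # t2" and d: "d = c"
      using keep.prems by auto
    from keep.IH[OF this(1)] obtain u1 e u2 s1 r1 r2 s2 k1 k2 k3 where
      "u = u1 @ e # u2" "t3 = s1 @ r1" "t2 = r2 @ s2"
      "k = k1 + k2 + k3" "expands C u1 s1 k1" "expands C u2 s2 k3"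
      "expands C [inv_letter b] (r2 @ inv_letter e # r1) k2"
      by blast
    then show ?thesis
      using Cons d expands.keep[of C u1 s1 k1 c]
      by - (rule exI[of _ "c # u1"], rule exI[of _ e], rule exI[of _ u2],
        rule exI[of _ "c # s1"], rule exI[of _ r1], rule exI[of _ r2], rule exI[of _ s2],
        rule exI[of _ k1], rule exI[of _ k2], rule exI[of _ k3], auto)
  qed
next
  case (replace c s ta ka u tb kb)
  from replace.prems show ?case
  proof (cases rule: append_eq_append_Cons_cases)
    case 1: (left t3)
    from replace.IH(1)[OF 1(1)] obtain u1 e u2 s1 r1 r2 s2 k1 k2 k3 where *:
      "s = u1 @ e # u2" "t1 = s1 @ r1" "t3 = r2 @ s2"
      "ka = k1 + k2 + k3" "expands C u1 s1 k1" "expands C u2 s2 k3"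
      "expands C [inv_letter b] (r2 @ inv_letter e # r1) k2"
      by blast
    \<comment> \<open>A rotation of the root face's boundary lets that face be entered through
      \<open>e\<close> instead of \<open>c\<close>, so that \<open>c\<close> becomes a leaf. The
      face is then grafted at the leaf \<open>inv_letter e\<close> of the tree that the induction
      hypothesis has rooted at \<open>b\<close>.\<close>
    have "e # u2 @ inv_letter c # u1 \<in> C"
      using C[of "inv_letter c # u1" "e # u2"] replace.hyps(1) * by simp
    moreover have "expands C (u2 @ [inv_letter c] @ u1) (s2 @ [inv_letter c] @ s1) (k3 + (0 + k1))"
      by (intro expands_append expands_refl *)
    ultimately have "expands C [inv_letter e] (s2 @ inv_letter c # s1) (Suc (k3 + k1))"
      using expands.replace[of "inv_letter e" "u2 @ inv_letter c # u1" C _ _ "[]" "[]" 0]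
      by (simp add: expands.Nil)
    from expands_replace_at[OF *(7) this]
    have "expands C [inv_letter b] ((r2 @ s2) @ inv_letter c # (s1 @ r1)) (k2 + Suc (k3 + k1))"
      by simp
    then show ?thesis
      using * 1 replace.hyps
      by - (rule exI[of _ "[]"], rule exI[of _ c], rule exI[of _ u], rule exI[of _ "[]"],
        rule exI[of _ "s1 @ r1"], rule exI[of _ "r2 @ s2"], rule exI[of _ tb],
        rule exI[of _ 0], rule exI[of _ "k2 + Suc (k3 + k1)"], rule exI[of _ kb],
        auto intro: expands.Nil)
  next
    case 2: (right t3)
    from replace.IH(2)[OF 2(2)] obtain u1 e u2 s1 r1 r2 s2 k1 k2 k3 where *:
      "u = u1 @ e # u2" "t3 = s1 @ r1" "t2 = r2 @ s2"
      "kb = k1 + k2 + k3" "expands C u1 s1 k1" "expands C u2 s2 k3"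
      "expands C [inv_letter b] (r2 @ inv_letter e # r1) k2"
      by blast
    then show ?thesis
      using 2 expands.replace[OF replace.hyps(1,2) *(5)]
      by - (rule exI[of _ "c # u1"], rule exI[of _ e], rule exI[of _ u2],
        rule exI[of _ "ta @ s1"], rule exI[of _ r1], rule exI[of _ r2],
        rule exI[of _ s2], rule exI[of _ "Suc (ka + k1)"], rule exI[of _ k2],
        rule exI[of _ k3], auto)
  qed
qed

text \<open>The boundary of a single tree is the cyclic word
  \<open>inv_letter c # t1 @ b # t2\<close>; re-rooting reads it from \<open>b\<close>
  onwards.\<close>

lemma expands_letter_reroot:
  assumes C: "\<And>p q. p @ q \<in> C \<Longrightarrow> q @ p \<in> C"
    and "expands C [c] (t1 @ b # t2) k"
  shows "expands C [inv_letter b] (t2 @ inv_letter c # t1) k"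
proof -
  have nil: "t = [] \<and> k = 0" if "expands C [] t k" for t k
    using that by cases auto
  show ?thesis
    using expands_reroot[OF C assms(2) HOL.refl]
    by (auto simp: append_eq_Cons_conv Cons_eq_append_conv dest!: nil)
qed

text \<open>If the trees above \<open>x\<close> and \<open>x\<inverse>\<close> do not cancel each other, some letter \<open>b\<close> of their joint
  frontier cancels a letter above \<open>u @ v\<close>; rooted at \<open>b\<close>, the joint tree is grafted there.\<close>

lemma expands_cancel:
  assumes C: "\<And>p q. p @ q \<in> C \<Longrightarrow> q @ p \<in> C"
    and ex: "expands C (u @ [x, inv_letter x] @ v) t k" and t: "free_eq A t []"
  shows "\<exists>t' k'. expands C (u @ v) t' k' \<and> k' \<le> k \<and> free_eq A t' []"
proof -
  obtain tu t1 k1 ku where 1: "t = tu @ t1" "k = ku + k1" "expands C u tu ku"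
      "expands C ([x] @ [inv_letter x] @ v) t1 k1"
    using expands_appendD[OF ex] by auto
  obtain tx t2 k2 kx where 2: "t1 = tx @ t2" "k1 = kx + k2" "expands C [x] tx kx"
      "expands C ([inv_letter x] @ v) t2 k2"
    using expands_appendD[OF 1(4)] by auto
  obtain ty tv ky kv where 3: "t2 = ty @ tv" "k2 = ky + kv" "expands C [inv_letter x] ty ky"
      "expands C v tv kv"
    using expands_appendD[OF 2(4)] by auto
  have t': "free_eq A (tu @ (tx @ ty) @ tv) []"
    using t 1 2 3 by simp
  have wds: "tu \<in> words A" "tv \<in> words A"
    using free_eq_words[OF t'] by auto
  have uv: "expands C (u @ v) (tu @ tv) (ku + kv)"
    using expands_append 1 3 by blast
  show ?thesis
  proof (cases "free_eq A (tx @ ty) []")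
    \<comment> \<open>The two trees cancel each other, and discarding them does not raise the face
      count.\<close>
    case True
    then have "free_eq A (tu @ tv) []"
      using free_eq_drop[OF True wds] t' by (meson free_eq.sym free_eq.trans)
    then show ?thesis
      using uv 1 2 3 by (intro exI conjI) auto
  next
    case False
    \<comment> \<open>Read cyclically, the frontier is the joint part \<open>tx @ ty\<close> against
      the rest \<open>tv @ tu\<close>.\<close>
    have "free_eq A ((tv @ tu) @ tx @ ty) []"
      using free_eq_rotate[of A "tu @ tx @ ty" tv] t' by simp
    from free_eq_append_Nil_cancel[OF this False] obtain x1 b x2 p q where *:
      "tv @ tu = x1 @ inv_letter b # x2" "tx @ ty = p @ b # q" "free_eq A x2 []" "free_eq A p []"
      by blast
    have wds': "x1 \<in> words A" "x2 \<in> words A" "p \<in> words A" "q \<in> words A" "b \<in> letters A"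
      using wds free_eq_words[OF t'] *
      by (auto dest: arg_cong[where f = "\<lambda>w. w \<in> words A"])
    have "free_eq A ((x1 @ [inv_letter b]) @ x2 @ (p @ b # q)) []"
      using \<open>free_eq A ((tv @ tu) @ tx @ ty) []\<close> * by simp
    then have "free_eq A ((x1 @ [inv_letter b]) @ (p @ b # q)) []"
      using free_eq_drop[OF *(3), of "x1 @ [inv_letter b]" "p @ b # q"] wds'
      by (auto intro: free_eq.sym free_eq.trans)
    then have "free_eq A ((x1 @ [inv_letter b]) @ (b # q)) []"
      using free_eq_drop[OF *(4), of "x1 @ [inv_letter b]" "b # q"] wds'
      by (auto intro: free_eq.sym free_eq.trans)
    then have x1q: "free_eq A (x1 @ q) []"
      using free_eq.cancel[of x1 A q "inv_letter b"] wds'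
      by (auto intro: free_eq.sym free_eq.trans)
    \<comment> \<open>Whichever of the two trees carries \<open>b\<close> is re-rooted there. Its
      old root becomes a leaf labelled by the root letter of the other tree, which is grafted onto
      that leaf.\<close>
    have joint: "expands C [inv_letter b] (q @ p) (kx + ky)"
    proof -
      from *(2) show ?thesis
      proof (cases rule: append_eq_append_Cons_cases)
        case (left q1)
        then show ?thesis
          using expands_replace_at[OF expands_letter_reroot[OF C, of x p b q1 kx] 3(3)] 2(3)
          by simp
      next
        case (right p1)
        then show ?thesis
          using expands_replace_at[of C "[inv_letter b]" q x p1 ky tx kx]
            expands_letter_reroot[OF C, of "inv_letter x" p1 b q ky] 3(3) \<open>expands C [x] tx kx\<close>
          by (simp add: ac_simps)
      qed
    qed
    \<comment> \<open>The partner of \<open>b\<close> lies above \<open>v\<close> or above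
      \<open>u\<close>. Replacing it by \<open>q @ p\<close> keeps the frontier freely trivial,
      since \<open>p\<close>, \<open>x2\<close> and \<open>x1 @ q\<close> are.\<close>
    from *(1) show ?thesis
    proof (cases rule: append_eq_append_Cons_cases)
      case 1: (left v2)
      have "expands C (u @ v) ((tu @ x1) @ (q @ p) @ v2) (ku + kv + (kx + ky))"
        by (rule expands_replace_at[OF _ joint]) (use uv 1 in simp)
      moreover have "free_eq A (tu @ x1 @ q @ p @ v2) []"
      proof -
        have "v2 \<in> words A"
          using wds' 1 by simp
        then have "free_eq A (tu @ (x1 @ q) @ (p @ v2)) (tu @ p @ v2)"
          "free_eq A (tu @ p @ v2) (tu @ v2)"
          using wds wds' by (auto intro!: free_eq_drop x1q * simp del: append_assoc)
        moreover have "free_eq A (tu @ v2) []"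
          using free_eq_rotate *(3) 1 by blast
        ultimately show ?thesis
          by (auto intro: free_eq.trans)
      qed
      ultimately show ?thesis
        using \<open>k = ku + k1\<close> \<open>k1 = kx + k2\<close> 3
        by - (rule exI[of _ "tu @ x1 @ q @ p @ v2"], rule exI[of _ "ku + kv + (kx + ky)"], auto)
    next
      case 2: (right u1)
      have "expands C (u @ v) (u1 @ (q @ p) @ x2 @ tv) (ku + kv + (kx + ky))"
        by (rule expands_replace_at[OF _ joint]) (use uv 2 in simp)
      moreover have "free_eq A (u1 @ q @ p @ x2 @ tv) []"
      proof -
        have "u1 \<in> words A"
          using wds' 2 by simp
        then have "free_eq A ((u1 @ q) @ p @ (x2 @ tv)) ((u1 @ q) @ x2 @ tv)"
          "free_eq A ((u1 @ q) @ x2 @ tv) ((u1 @ q) @ tv)"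
          using wds wds' by (auto intro!: free_eq_drop * simp del: append_assoc)
        moreover have "free_eq A ((u1 @ q) @ tv) []"
          using free_eq_rotate[of A tv "u1 @ q"] x1q 2 by simp
        ultimately show ?thesis
          by (auto intro: free_eq.trans)
      qed
      ultimately show ?thesis
        using \<open>k = ku + k1\<close> \<open>k1 = kx + k2\<close> 3
        by - (rule exI[of _ "u1 @ q @ p @ x2 @ tv"], rule exI[of _ "ku + kv + (kx + ky)"], auto)
    qed
  qed
qed

text \<open>The equivalence makes the symmetry case of the induction immediate. The bound
  \<open>n\<close> replaces an exact count because cancellation may discard faces.\<close>

lemma expands_free_eq:
  assumes C: "\<And>p q. p @ q \<in> C \<Longrightarrow> q @ p \<in> C"
    and "free_eq A u v"
  shows "(\<exists>t k. expands C u t k \<and> k \<le> n \<and> free_eq A t []) \<longleftrightarrow>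
    (\<exists>t k. expands C v t k \<and> k \<le> n \<and> free_eq A t [])"
  using assms(2)
proof (induction rule: free_eq.induct)
  case (cancel u v x)
  show ?case
  proof
    assume "\<exists>t k. expands C (u @ [x, inv_letter x] @ v) t k \<and> k \<le> n \<and> free_eq A t []"
    then obtain t k where *: "expands C (u @ [x, inv_letter x] @ v) t k" "k \<le> n" "free_eq A t []"
      by blast
    from expands_cancel[OF C *(1,3)] show "\<exists>t k. expands C (u @ v) t k \<and> k \<le> n \<and> free_eq A t []"
      using *(2) le_trans by blast
  next
    assume "\<exists>t k. expands C (u @ v) t k \<and> k \<le> n \<and> free_eq A t []"
    then obtain t k where "expands C (u @ v) t k" "k \<le> n" "free_eq A t []"
      by blast
    then obtain t1 t2 k1 k2 where *: "expands C u t1 k1" "expands C v t2 k2" "k1 + k2 \<le> n"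
        "free_eq A (t1 @ t2) []"
      using expands_appendD[of C u v t k] by auto
    then have "expands C (u @ [x, inv_letter x] @ v) (t1 @ [x, inv_letter x] @ t2) (k1 + (0 + k2))"
      by (intro expands_append expands_refl)
    moreover have "free_eq A (t1 @ [x, inv_letter x] @ t2) []"
      using free_eq.trans[OF free_eq.cancel *(4)] free_eq_words[OF *(4)] cancel by simp
    ultimately show "\<exists>t k. expands C (u @ [x, inv_letter x] @ v) t k \<and> k \<le> n \<and> free_eq A t []"
      using *(3) by auto
  qed
qed auto

section \<open>Peeling products of conjugated relators\<close>

text \<open>The symmetrized relators: face boundaries read in either direction from any starting
  edge, as re-rooting requires.\<close>

definition rotations :: "'a word set \<Rightarrow> 'a word set" where
  "rotations R = {q @ p | p q. p @ q \<in> sym_relators R}"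

lemma sym_relators_inv: "r \<in> sym_relators R \<Longrightarrow> inv_word r \<in> sym_relators R"
  by (auto simp: sym_relators_def)

lemma sym_relators_words: "R \<subseteq> words A \<Longrightarrow> sym_relators R \<subseteq> words A"
  by (auto simp: sym_relators_def)

lemma rotations_rotate:
  assumes "p @ q \<in> rotations R"
  shows "q @ p \<in> rotations R"
proof -
  obtain a b where *: "p @ q = b @ a" "a @ b \<in> sym_relators R"
    using assms by (auto simp: rotations_def)
  from *(1) consider c where "p = b @ c" "a = c @ q" | c where "b = p @ c" "q = c @ a"
    by (auto simp: append_eq_append_conv2)
  then show ?thesis
  proof cases
    case 1
    then have "c @ (q @ b) \<in> sym_relators R" "q @ p = (q @ b) @ c"
      using * by auto
    then show ?thesis unfolding rotations_def by blast
  next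
    case 2
    then have "(a @ p) @ c \<in> sym_relators R" "q @ p = c @ (a @ p)"
      using * by auto
    then show ?thesis unfolding rotations_def by blast
  qed
qed

lemma rotations_words: "R \<subseteq> words A \<Longrightarrow> rotations R \<subseteq> words A"
  using sym_relators_words[of R A] by (auto simp: rotations_def)

text \<open>Crossing one face through the first letter of \<open>r = a # s\<close> turns
  \<open>a\<close> into \<open>inv_word s\<close>, which cancels the remaining
  \<open>s\<close>.\<close>

lemma expands_conj_word:
  assumes R: "R \<subseteq> words A" "[] \<notin> R" and r: "r \<in> sym_relators R" and x: "x \<in> words A"
  shows "\<exists>t. expands (rotations R) (conj_word r x) t 1 \<and> free_eq A t []"
proof -
  obtain a s where as: "r = a # s"
    using R r by (cases r) (auto simp: sym_relators_def inv_word_def)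
  have s: "s \<in> words A"
    using as r sym_relators_words[OF R(1)] by auto
  have "inv_word s @ [inv_letter a] \<in> sym_relators R"
    using sym_relators_inv[OF r] as by simp
  then have "[inv_letter a] @ inv_word s \<in> rotations R"
    unfolding rotations_def by blast
  then have "expands (rotations R) [a] (inv_word s) 1"
    using expands.replace[of a "inv_word s" "rotations R" _ 0 "[]" "[]" 0]
    by (simp add: expands.Nil expands_refl)
  then have "expands (rotations R) (inv_word x @ [a] @ (s @ x))
      (inv_word x @ inv_word s @ (s @ x)) (0 + (1 + 0))"
    by (intro expands_append expands_refl)
  moreover have "free_eq A (inv_word (s @ x) @ (s @ x)) []"
    using s x by (intro free_eq_inv_word) auto
  ultimately show ?thesis
    by (auto simp: as conj_word_def)
qed

lemma expands_conj_words:
  assumes R: "R \<subseteq> words A" "[] \<notin> R"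
  shows "set rxs \<subseteq> sym_relators R \<times> words A \<Longrightarrow>
    \<exists>t. expands (rotations R) (concat (map (\<lambda>(r, x). conj_word r x) rxs)) t (length rxs) \<and>
      free_eq A t []"
proof (induction rxs)
  case Nil
  show ?case
    using expands.Nil[of "rotations R"] free_eq.refl[of "[]" A] by auto
next
  case (Cons rx rxs)
  obtain r x where rx: "rx = (r, x)" by (cases rx)
  obtain t where t: "expands (rotations R) (concat (map (\<lambda>(r, x). conj_word r x) rxs)) t (length rxs)"
      "free_eq A t []"
    using Cons by auto
  obtain t' where t': "expands (rotations R) (conj_word r x) t' 1" "free_eq A t' []"
    using expands_conj_word[OF R, of r x] Cons.prems rx by auto
  show ?case
    using expands_append[OF t'(1) t(1)] free_eq_append[OF t'(2) t(2)] rx by auto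
qed

section \<open>Derivations with counted relator applications\<close>

text \<open>Relators are inserted or deleted in place, so counts add under concatenation without
  tracking conjugators; \<open>derivable_conj_words\<close> recovers these.\<close>

inductive derivable :: "'a set \<Rightarrow> 'a word set \<Rightarrow> nat \<Rightarrow> 'a word \<Rightarrow> 'a word \<Rightarrow> bool" for A S where
  free: "free_eq A u v \<Longrightarrow> derivable A S 0 u v"
| relator: "r \<in> sym_relators S \<Longrightarrow> u \<in> words A \<Longrightarrow> v \<in> words A \<Longrightarrow>
    derivable A S 1 (u @ r @ v) (u @ v)"
| sym: "derivable A S m u v \<Longrightarrow> derivable A S m v u"
| trans: "derivable A S m u v \<Longrightarrow> derivable A S n v w \<Longrightarrow> derivable A S (m + n) u w"

lemma derivable_words:
  "derivable A S m u v \<Longrightarrow> S \<subseteq> words A \<Longrightarrow> u \<in> words A \<and> v \<in> words A"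
proof (induction rule: derivable.induct)
  case (relator r u v)
  then show ?case
    using sym_relators_words[of S A] by auto
qed (auto dest: free_eq_words)

lemma derivable_append_left:
  "derivable A S m u v \<Longrightarrow> w \<in> words A \<Longrightarrow> derivable A S m (w @ u) (w @ v)"
proof (induction rule: derivable.induct)
  case (relator r u v)
  then show ?case
    using derivable.relator[of r S "w @ u" A v] by simp
qed (auto intro: derivable.intros free_eq_append_left)

lemma derivable_append_right:
  "derivable A S m u v \<Longrightarrow> w \<in> words A \<Longrightarrow> derivable A S m (u @ w) (v @ w)"
proof (induction rule: derivable.induct)
  case (relator r u v)
  then show ?case
    using derivable.relator[of r S u A "v @ w"] by simp
qed (auto intro: derivable.intros free_eq_append_right)

lemma derivable_append:
  assumes "S \<subseteq> words A" "derivable A S m u v" "derivable A S n u' v'"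
  shows "derivable A S (m + n) (u @ u') (v @ v')"
  using assms derivable_words
  by (meson derivable.trans derivable_append_left derivable_append_right)

lemma derivable_letter:
  assumes "derivable A S m (inv_letter b # s) []" "b \<in> letters A" "s \<in> words A"
  shows "derivable A S m [b] s"
proof -
  have "derivable A S m ([b] @ inv_letter b # s) ([b] @ [])"
    using assms by (intro derivable_append_left) auto
  moreover have "free_eq A ([] @ [b, inv_letter b] @ s) ([] @ s)"
    using assms by (intro free_eq.cancel) auto
  ultimately show ?thesis
    using derivable.trans[OF derivable.sym derivable.free] by fastforce
qed

text \<open>\<open>q @ p\<close> is freely equal to the conjugate
  \<open>inv_word p @ (p @ q) @ p\<close>, so a rotation costs one relator.\<close>

lemma derivable_rotations:
  assumes "S \<subseteq> words A" "r \<in> rotations S"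
  shows "derivable A S 1 r []"
proof -
  obtain p q where *: "r = q @ p" "p @ q \<in> sym_relators S"
    using assms by (auto simp: rotations_def)
  have w: "p \<in> words A" "q \<in> words A"
    using sym_relators_words[OF assms(1)] * by auto
  have "derivable A S (1 + 0) (inv_word p @ (p @ q) @ p) []"
    by (rule derivable.trans[OF derivable.relator derivable.free])
      (use * w free_eq_inv_word in auto)
  moreover have "free_eq A (inv_word p @ p @ q @ p) (q @ p)"
    using free_eq_append_right[OF free_eq_inv_word[OF w(1)], of "q @ p"] w by simp
  then have "derivable A S 0 (q @ p) (inv_word p @ (p @ q) @ p)"
    by (auto intro: derivable.free free_eq.sym)
  ultimately show ?thesis
    using derivable.trans[of A S 0 "q @ p" _ "1 + 0" "[]"] * by simp
qed

lemma inv_word_conj_words: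
  "inv_word (concat (map (\<lambda>(r, x). conj_word r x) rxs)) =
    concat (map (\<lambda>(r, x). conj_word r x) (rev (map (map_prod inv_word id) rxs)))"
  by (induction rxs) (auto simp: conj_word_def)

lemma conj_words_words:
  "set rxs \<subseteq> sym_relators S \<times> words A \<Longrightarrow> S \<subseteq> words A \<Longrightarrow>
    concat (map (\<lambda>(r, x). conj_word r x) rxs) \<in> words A"
  using sym_relators_words[of S A] by (induction rxs) (auto simp: conj_word_def)

text \<open>A relator inserted after the prefix \<open>u\<close> is its conjugate by
  \<open>inv_word u\<close>; reversing a derivation inverts the product of conjugates.\<close>

lemma derivable_conj_words:
  "derivable A S m u v \<Longrightarrow> S \<subseteq> words A \<Longrightarrow>
    \<exists>rxs. set rxs \<subseteq> sym_relators S \<times> words A \<and> length rxs = m \<and>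
      free_eq A u (concat (map (\<lambda>(r, x). conj_word r x) rxs) @ v)"
proof (induction rule: derivable.induct)
  case (free u v)
  then show ?case by auto
next
  case (relator r u v)
  then have w: "r \<in> words A"
    using sym_relators_words by blast
  have "free_eq A ((u @ r) @ (inv_word u @ u) @ v) ((u @ r) @ v)"
    using relator w by (intro free_eq_drop free_eq_inv_word) auto
  then show ?case
    using relator by (intro exI[of _ "[(r, inv_word u)]"]) (auto simp: conj_word_def intro: free_eq.sym)
next
  case (sym m u v)
  then obtain rxs where *: "set rxs \<subseteq> sym_relators S \<times> words A" "length rxs = m"
      "free_eq A u (concat (map (\<lambda>(r, x). conj_word r x) rxs) @ v)"
    by blast
  have "v \<in> words A"
    using sym derivable_words by blast
  then have "free_eq A v (inv_word (concat (map (\<lambda>(r, x). conj_word r x) rxs)) @ u)"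
    using * conj_words_words[OF *(1)] sym.prems
    by (intro free_eq_move_left) (auto intro: free_eq.sym)
  then show ?case
    using * unfolding inv_word_conj_words
    by (intro exI[of _ "rev (map (map_prod inv_word id) rxs)"]) (auto intro: sym_relators_inv)
next
  case (trans m u v n w)
  then obtain rxs rxs' where *: "set rxs \<subseteq> sym_relators S \<times> words A" "length rxs = m"
      "free_eq A u (concat (map (\<lambda>(r, x). conj_word r x) rxs) @ v)"
      "set rxs' \<subseteq> sym_relators S \<times> words A" "length rxs' = n"
      "free_eq A v (concat (map (\<lambda>(r, x). conj_word r x) rxs') @ w)"
    by blast
  have "free_eq A u (concat (map (\<lambda>(r, x). conj_word r x) rxs) @
      concat (map (\<lambda>(r, x). conj_word r x) rxs') @ w)"
    using free_eq.trans[OF *(3) free_eq_append_left[OF *(6) conj_words_words[OF *(1) trans.prems]]] .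
  then show ?case
    using *(1,2,4,5) by (intro exI[of _ "rxs @ rxs'"]) simp
qed

section \<open>Bounded groups of faces as new relators\<close>

text \<open>Taking all consequences up to a length avoids describing the boundaries of groups; the
  length bound alone gives finiteness over a finite alphabet.\<close>

definition short_consequences :: "'a set \<Rightarrow> 'a word set \<Rightarrow> nat \<Rightarrow> 'a word set" where
  "short_consequences A R l = {w \<in> words A. w \<noteq> [] \<and> length w \<le> l \<and> (\<exists>j. derivable A R j w [])}"

lemma derivable_short_consequences:
  assumes "w \<in> short_consequences A R l"
  shows "derivable A (short_consequences A R l) 1 w []"
  using derivable.relator[of w "short_consequences A R l" "[]" A "[]"] assms
  by (simp add: sym_relators_def)

lemma short_consequences_words: "short_consequences A R l \<subseteq> words A"
  by (auto simp: short_consequences_def)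

text \<open>Grouping the faces of a tree from its leaves upwards: a face some of whose children are still
  single forms a group together with these children, any other face stays single. In \<open>z\<close> exactly
  the \<open>p\<close> letters of \<open>u\<close> that carry a single face have been replaced; all other faces lie in one of
  \<open>m\<close> groups of size at least two.\<close>

lemma expands_grouping:
  assumes R: "R \<subseteq> words A" and L: "\<And>r. r \<in> rotations R \<Longrightarrow> length r \<le> L"
  defines "S \<equiv> short_consequences A R (L + L * L)"
  shows "expands (rotations R) u t k \<Longrightarrow> u \<in> words A \<Longrightarrow>
    \<exists>z p m. p \<le> length u \<and> 2 * m + p \<le> k \<and> length z \<le> length u + p * L \<and>
      derivable A S p u z \<and> derivable A S m z t \<and> (\<exists>j. derivable A R j u z) \<and> (p = 0 \<longrightarrow> z = u)"
proof (induction rule: expands.induct)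
  case Nil
  then show ?case
    using derivable.free[OF free_eq.refl[OF words_Nil]]
    by - (rule exI[of _ "[]"], rule exI[of _ 0], rule exI[of _ 0], auto)
next
  case (keep u t k b)
  then obtain z p m j where *: "p \<le> length u" "2 * m + p \<le> k" "length z \<le> length u + p * L"
      "derivable A S p u z" "derivable A S m z t" "derivable A R j u z" "p = 0 \<longrightarrow> z = u"
    by auto
  have b: "[b] \<in> words A"
    using keep by simp
  show ?case
    using *(1-3,7) *(4-6)[THEN derivable_append_left, OF b]
    by - (rule exI[of _ "b # z"], rule exI[of _ p], rule exI[of _ m], auto)
next
  case (replace b s t1 k1 u t2 k2)
  have S: "S \<subseteq> words A"
    unfolding S_def by (rule short_consequences_words)
  have b: "b \<in> letters A" and u: "u \<in> words A"
    using replace.prems by auto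
  have bs: "inv_letter b # s \<in> words A" "length s + 1 \<le> L"
    using rotations_words[OF R] L[OF replace.hyps(1)] replace.hyps(1) by auto
  obtain z1 p1 m1 j1 where 1: "p1 \<le> length s" "2 * m1 + p1 \<le> k1"
      "length z1 \<le> length s + p1 * L" "derivable A S p1 s z1" "derivable A S m1 z1 t1"
      "derivable A R j1 s z1" "p1 = 0 \<longrightarrow> z1 = s"
    using replace.IH(1) bs by auto
  obtain z2 p2 m2 j2 where 2: "p2 \<le> length u" "2 * m2 + p2 \<le> k2"
      "length z2 \<le> length u + p2 * L" "derivable A S p2 u z2" "derivable A S m2 z2 t2"
      "derivable A R j2 u z2" "p2 = 0 \<longrightarrow> z2 = u"
    using replace.IH(2) u by auto
  have z1: "z1 \<in> words A"
    using derivable_words[OF 1(4) S] by simp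
  \<comment> \<open>This is the purpose of the derivation over \<open>R\<close> in the induction: it
    shows that the boundary of the group at \<open>b\<close> is a consequence of \<open>R\<close>.
    Its count is immaterial.\<close>
  have "derivable A R j1 (inv_letter b # s) (inv_letter b # z1)"
    using derivable_append_left[OF 1(6), of "[inv_letter b]"] b by simp
  then have jz: "derivable A R (j1 + 1) (inv_letter b # z1) []"
    using derivable.trans[OF derivable.sym derivable_rotations[OF R replace.hyps(1)]] by blast
  \<comment> \<open>The root face contributes at most \<open>L\<close> letters, and each of its at
    most \<open>L\<close> single children at most \<open>L\<close> more; this is the source of
    \<open>L + L * L\<close>.\<close>
  have "p1 * L \<le> L * L"
    using 1 bs by (intro mult_right_mono) auto
  then have "length (inv_letter b # z1) \<le> L + L * L"
    using 1(3) bs(2) unfolding length_Cons by linarith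
  then have "inv_letter b # z1 \<in> S"
    unfolding S_def short_consequences_def using b z1 jz by auto
  then have bz: "derivable A S 1 [b] z1"
    unfolding S_def by (intro derivable_letter derivable_short_consequences b z1)
  show ?case
  proof (cases "p1 = 0")
    \<comment> \<open>No child is single, so the face at \<open>b\<close> stays single and raises
      \<open>p\<close> by one.\<close>
    case True
    then have "z1 = s"
      using 1 by simp
    have "derivable A S (1 + p2) ([b] @ u) (s @ z2)"
      using bz 2 \<open>z1 = s\<close> by (intro derivable_append[OF S]) auto
    moreover have "derivable A S (m1 + m2) (s @ z2) (t1 @ t2)"
      using 1 2 \<open>z1 = s\<close> by (intro derivable_append[OF S]) auto
    moreover have "derivable A R (j1 + 1 + j2) ([b] @ u) (s @ z2)"
      using derivable_letter[OF jz b z1] 2 \<open>z1 = s\<close> by (intro derivable_append[OF R]) auto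
    ultimately show ?thesis
      using 1(2) 2(1-3) True bs(2)
      by - (rule exI[of _ "s @ z2"], rule exI[of _ "1 + p2"], rule exI[of _ "m1 + m2"], auto)
  next
    \<comment> \<open>One relator of \<open>S\<close> takes \<open>b\<close> straight to
      \<open>z1\<close>, covering the face and its \<open>p1\<close> single children. Since
      \<open>p1\<close> is at least one, the new group has at least two faces, which pays for
      raising \<open>m\<close> by one.\<close>
    case False
    have "derivable A S (1 + m1 + m2) ([b] @ z2) (t1 @ t2)"
      using derivable.trans[OF bz 1(5)] 2 by (intro derivable_append[OF S]) auto
    moreover have "derivable A S p2 ([b] @ u) ([b] @ z2)" "derivable A R j2 ([b] @ u) ([b] @ z2)"
      using 2 b by (auto intro!: derivable_append_left simp del: append_Cons)
    ultimately show ?thesis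
      using 1(2) 2(1-3,7) False
      by - (rule exI[of _ "b # z2"], rule exI[of _ p2], rule exI[of _ "1 + m1 + m2"], auto)
  qed
qed

section \<open>The new relators are finite in number and present the same group\<close>

lemma finite_short_consequences: "finite A \<Longrightarrow> finite (short_consequences A R l)"
proof -
  assume "finite A"
  then have "finite {w. set w \<subseteq> letters A \<and> length w \<le> l}"
    by (intro finite_lists_length_le) (simp add: letters_def)
  then show ?thesis
    by (rule rev_finite_subset) (auto simp: short_consequences_def words_def)
qed

lemma free_group_one: "\<one>\<^bsub>free_group A\<^esub> = free_class A []"
  by (simp add: free_group_def)

lemma free_class_inv_word:
  assumes "w \<in> words A"
  shows "inv\<^bsub>free_group A\<^esub> free_class A w = free_class A (inv_word w)"
proof -
  interpret group "free_group A" by (rule group_free_group)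
  have "free_class A (inv_word w) \<otimes>\<^bsub>free_group A\<^esub> free_class A w = \<one>\<^bsub>free_group A\<^esub>"
    using assms by (simp add: free_group_mult free_class_eq_iff free_eq_inv_word free_group_one)
  then show ?thesis
    using assms by (intro inv_equality) (auto simp: free_group_carrier)
qed

lemma conj_words_in_normal:
  assumes N: "N \<lhd> free_group A" and S: "S \<subseteq> words A" "free_class A ` S \<subseteq> N"
  shows "set rxs \<subseteq> sym_relators S \<times> words A \<Longrightarrow>
    free_class A (concat (map (\<lambda>(r, x). conj_word r x) rxs)) \<in> N"
proof (induction rxs)
  case Nil
  show ?case
    using subgroup.one_closed[OF normal_imp_subgroup[OF N], unfolded free_group_one] by simp
next
  interpret normal N "free_group A" by fact
  case (Cons rx rxs)
  obtain r x where rx: "rx = (r, x)" by (cases rx)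
  have x: "x \<in> words A" and r: "r \<in> sym_relators S"
    using Cons.prems rx by auto
  have rw: "r \<in> words A"
    using r sym_relators_words[OF S(1)] by blast
  have "free_class A r \<in> N"
  proof (cases "r \<in> S")
    case False
    then obtain r' where r': "r' \<in> S" "r = inv_word r'"
      using r by (auto simp: sym_relators_def)
    then have "inv\<^bsub>free_group A\<^esub> free_class A r' \<in> N"
      using S(2) by (intro m_inv_closed) blast
    then show ?thesis
      using r' S(1) by (simp add: free_class_inv_word subset_iff)
  qed (use S(2) in blast)
  then have "inv\<^bsub>free_group A\<^esub> free_class A x \<otimes>\<^bsub>free_group A\<^esub> free_class A r
      \<otimes>\<^bsub>free_group A\<^esub> free_class A x \<in> N"
    using x by (intro inv_op_closed1) (auto simp: free_group_carrier)
  then have "free_class A (conj_word r x) \<in> N"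
    using x rw by (simp add: free_class_inv_word free_group_mult conj_word_def)
  then have "free_class A (conj_word r x) \<otimes>\<^bsub>free_group A\<^esub>
      free_class A (concat (map (\<lambda>(r, x). conj_word r x) rxs)) \<in> N"
    using Cons.IH Cons.prems by (intro subgroup.m_closed[OF normal_imp_subgroup[OF N]]) simp_all
  moreover have "concat (map (\<lambda>(r, x). conj_word r x) rxs) \<in> words A"
    using Cons.prems S(1) by (intro conj_words_words) auto
  ultimately show ?case
    using x rw rx by (simp add: free_group_mult conj_word_def)
qed

lemma relator_closure_normal:
  assumes "R \<subseteq> words A"
  shows "relator_closure A R \<lhd> free_group A"
  unfolding relator_closure_def using assms
  by (intro normal_closure_normal group_free_group) (auto simp: free_group_carrier)

lemma relator_closure_superset: "free_class A ` R \<subseteq> relator_closure A R"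
  by (auto simp: relator_closure_def normal_closure_def)

lemma relator_closure_least:
  "N \<lhd> free_group A \<Longrightarrow> free_class A ` R \<subseteq> N \<Longrightarrow> relator_closure A R \<subseteq> N"
  by (auto simp: relator_closure_def normal_closure_def)

lemma derivable_relator_closure:
  assumes "R \<subseteq> words A" "derivable A R j w []"
  shows "free_class A w \<in> relator_closure A R"
proof -
  obtain rxs where *: "set rxs \<subseteq> sym_relators R \<times> words A"
      "free_eq A w (concat (map (\<lambda>(r, x). conj_word r x) rxs))"
    using derivable_conj_words[OF assms(2,1)] by auto
  have "free_class A w = free_class A (concat (map (\<lambda>(r, x). conj_word r x) rxs))"
    using * free_eq_words by (metis free_class_eq_iff)
  then show ?thesis
    using conj_words_in_normal[OF relator_closure_normal[OF assms(1)] assms(1)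
      relator_closure_superset *(1)] by simp
qed

text \<open>Each closure contains the generators of the other: consequences of \<open>R\<close> lie
  in its closure, and with \<open>l\<close> large enough \<open>R\<close> itself consists of short
  consequences.\<close>

lemma relator_closure_short_consequences:
  assumes "R \<subseteq> words A" "[] \<notin> R" "\<And>r. r \<in> R \<Longrightarrow> length r \<le> l"
  shows "relator_closure A (short_consequences A R l) = relator_closure A R"
proof
  show "relator_closure A (short_consequences A R l) \<subseteq> relator_closure A R"
    using assms(1)
    by (intro relator_closure_least relator_closure_normal)
      (auto simp: short_consequences_def intro: derivable_relator_closure)
  have "derivable A R 1 r []" if "r \<in> R" for r
    using derivable.relator[of r R "[]" A "[]"] that by (simp add: sym_relators_def)
  then have "R \<subseteq> short_consequences A R l"
    using assms by (fastforce simp: short_consequences_def)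
  then have "free_class A ` R \<subseteq> relator_closure A (short_consequences A R l)"
    using relator_closure_superset[of A "short_consequences A R l"] by blast
  then show "relator_closure A R \<subseteq> relator_closure A (short_consequences A R l)"
    by (intro relator_closure_least relator_closure_normal short_consequences_words)
qed

theorem theorem3p1:
  fixes G :: "('g, 'm) monoid_scheme"
    and A :: "'a set" and R :: "'a word set"
    and P :: "nat \<Rightarrow> real"
  assumes "group G"
    and "has_finite_presentation G A R"
    and "isoperimetric_le A R P"
  shows "\<exists>(B :: 'a set) (S :: 'a word set).
           has_finite_presentation G B S \<and>
           isoperimetric_le B S (\<lambda>n. P n / 2 + real n / 2)"
proof -
  have fin: "finite A" "finite R" and R: "R \<subseteq> words A" "[] \<notin> R"
    and iso: "G \<cong> presented_group A R"
    using assms(2) by (auto simp: has_finite_presentation_def finite_presentation_def)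
  obtain L where L: "\<And>r. r \<in> R \<Longrightarrow> length r \<le> L"
    using finite_imageI[OF fin(2), of length] unfolding finite_nat_set_iff_bounded_le by blast
  have L': "length r \<le> L" if "r \<in> rotations R" for r
  proof -
    obtain p q where "r = q @ p" "p @ q \<in> sym_relators R"
      using \<open>r \<in> rotations R\<close> by (auto simp: rotations_def)
    moreover have "length r' \<le> L" if "r' \<in> sym_relators R" for r'
      using that L by (auto simp: sym_relators_def)
    ultimately have "length (p @ q) \<le> L" "r = q @ p"
      by blast+
    then show ?thesis
      by simp
  qed
  define S where "S = short_consequences A R (L + L * L)"
  have S: "S \<subseteq> words A" "[] \<notin> S" "finite S"
    using finite_short_consequences[OF fin(1)] by (auto simp: S_def short_consequences_def)
  have closure: "relator_closure A S = relator_closure A R"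
    unfolding S_def using R L by (intro relator_closure_short_consequences) (auto intro: trans_le_add1)
  have "has_finite_presentation G A S"
    using iso S fin closure
    by (simp add: has_finite_presentation_def finite_presentation_def presented_group_def)
  moreover have "isoperimetric_le A S (\<lambda>n. P n / 2 + real n / 2)"
    unfolding isoperimetric_le_def
  proof (intro ballI impI)
    fix w
    assume w: "w \<in> words A" and "word_value A S w = \<one>\<^bsub>presented_group A S\<^esub>"
    then have "word_value A R w = \<one>\<^bsub>presented_group A R\<^esub>"
      by (simp add: word_value_eq_one_iff S R closure)
    then obtain rxs where rxs: "set rxs \<subseteq> sym_relators R \<times> words A"
        "free_eq A w (concat (map (\<lambda>(r, x). conj_word r x) rxs))" "real (length rxs) \<le> P (length w)"
      using assms(3) w unfolding isoperimetric_le_def by blast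
    \<comment> \<open>The product of conjugates peels with one face per factor; invariance under
      free equality carries the bound over to \<open>w\<close>.\<close>
    have "\<exists>t k. expands (rotations R) w t k \<and> k \<le> length rxs \<and> free_eq A t []"
      using expands_conj_words[OF R rxs(1)]
      by (intro expands_free_eq[OF rotations_rotate rxs(2), THEN iffD2]) auto
    then obtain t k where t: "expands (rotations R) w t k" "k \<le> length rxs" "free_eq A t []"
      by blast
    obtain z p m where z: "p \<le> length w" "2 * m + p \<le> k" "derivable A S p w z" "derivable A S m z t"
      using expands_grouping[OF R(1) L' t(1) w, folded S_def] by blast
    have "derivable A S (p + m + 0) w []"
      by (rule derivable.trans[OF derivable.trans[OF z(3,4)] derivable.free[OF t(3)]])
    then obtain sxs where sxs: "set sxs \<subseteq> sym_relators S \<times> words A" "length sxs = p + m"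
        "free_eq A w (concat (map (\<lambda>(r, x). conj_word r x) sxs))"
      using derivable_conj_words[of A S "p + m + 0" w "[]"] S(1) by auto
    \<comment> \<open>Twice \<open>p + m\<close> is \<open>(2 * m + p) + p\<close>: the bracket is
      at most \<open>k\<close>, and the last \<open>p\<close> counts single roots, at most one per
      letter of \<open>w\<close>.\<close>
    have "2 * real (length sxs) \<le> real k + real (length w)"
      using z sxs(2) by simp
    then have "real (length sxs) \<le> P (length w) / 2 + real (length w) / 2"
      using rxs(3) t(2) by simp
    with sxs show "\<exists>rxs. set rxs \<subseteq> sym_relators S \<times> words A \<and>
        free_eq A w (concat (map (\<lambda>(r, x). conj_word r x) rxs)) \<and>
        real (length rxs) \<le> P (length w) / 2 + real (length w) / 2"
      by blast
  qed
  ultimately show ?thesis by blast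
qed

end
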